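(* Let $\{\lambda_n\}_{n\ge 0}$ be a sequence with $\lambda_n\to\infty$ as $n\to\infty$. Then for every increasing continuous function $\omega$ on $[0,\infty)$ with $\omega(0)=0$ there exists a homeomorphism $h$ of the circle $T$ onto itself such that for every $f\in H^\omega(T)$ $$|\widehat{f\circ h}(k)|=O\left(\frac{\lambda_{|k|}}{|k|}\right),\qquad |k|\to\infty .$$
   Context: $T=\mathbb{R}/2\pi\mathbb{Z}$ is the circle. The Fourier coefficients of an integrable function $x$ on $T$ are $\widehat{x}(k)=\frac{1}{2\pi}\int_T x(t)e^{-ikt}\,dt$, $k\in\mathbb{Z}$. For an increasing continuous function $\omega$ on $[0,\infty)$ with $\omega(0)=0$, $H^\omega(T)$ denotes the class of real-valued functions $f$ on $T$ with $\omega(\delta,f)=O(\omega(\delta))$ as $\delta\to 0^+$, where $\omega(\delta,f)=\sup_{|t_1-t_2|<\delta}|f(t_1)-f(t_2)|$ is the uniform modulus of continuity of $f$. The constant in the $O$ of the conclusion may depend on $f$. *)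

theory Defs
  imports
    "HOL-Analysis.Analysis"
    "HOL-Library.Landau_Symbols"
    "HOL-Library.Real_Mod"
begin

quotient_type circle = real / "\<lambda>s t. [s = t] (rmod (2 * pi))"
  morphisms circle_rep circle_of
  by (intro equivpI reflpI sympI transpI) (auto intro: rcong_sym rcong_trans)

instantiation circle :: topological_space
begin

definition open_circle :: "circle set \<Rightarrow> bool" where
  "open_circle U \<longleftrightarrow> open (circle_of -` U)"

instance
  by standard (auto simp: open_circle_def vimage_Int vimage_Union intro: open_Int)

end

definition fourier_coeff :: "(circle \<Rightarrow> complex) \<Rightarrow> int \<Rightarrow> complex" where
  "fourier_coeff x k =
     1 / (2 * pi) * (LINT t:{0..2 * pi}|lebesgue. x (circle_of t) * exp (- (\<i> * of_int k * of_real t)))"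

text \<open>
  The points of the circle are given by real representatives. Two points are at distance less
  than \<open>\<delta>\<close> on the circle iff they have representatives at distance less than \<open>\<delta>\<close>.
  The supremum is taken in the extended reals, as it is infinite for an unbounded function.
\<close>

definition modulus_of_continuity :: "real \<Rightarrow> (circle \<Rightarrow> real) \<Rightarrow> ereal" where
  "modulus_of_continuity \<delta> f =
     (SUP (s, t) \<in> {(s, t). \<bar>s - t\<bar> < \<delta>}. ereal \<bar>f (circle_of s) - f (circle_of t)\<bar>)"

definition H_class :: "(real \<Rightarrow> real) \<Rightarrow> (circle \<Rightarrow> real) set" where
  "H_class \<omega> =
     {f. \<exists>C. \<forall>\<^sub>F \<delta> in at_right 0. modulus_of_continuity \<delta> f \<le> ereal (C * \<omega> \<delta>)}"

end

theory Submission
  imports Defs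
begin

text \<open>
  A function that takes only \<open>N\<close> values, each on an interval, has Fourier coefficients
  \<open>O(N / \<bar>k\<bar>)\<close>, so \<open>f \<circ> h\<close> has a coefficient of size \<open>O(\<lambda>\<^sub>k / \<bar>k\<bar>)\<close> as soon as it is
  \<open>O(1 / \<bar>k\<bar>)\<close>-close in mean to a step function with at most \<open>\<lambda>\<^sub>k\<close> steps. The homeomorphism \<open>h\<close> is
  built so that every \<open>f\<close> in the class is extremely close to step functions with few steps:
  each of the \<open>4\<^sup>r\<close> intervals of the \<open>r\<close>-th generation contains a subinterval that is almost all
  of it (all but a fraction \<open>\<delta>\<^sub>r\<close>) and whose image under \<open>h\<close> is no longer than \<open>\<epsilon>\<^sub>r\<close>. On that
  subinterval \<open>f \<circ> h\<close> varies by \<open>O(\<omega>(8 \<epsilon>\<^sub>r))\<close> only (the factor \<open>8\<close> absorbs \<open>2\<pi>\<close>), whence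
  \<open>\<bar>(f \<circ> h)^(k)\<bar> = O(4\<^sup>r / \<bar>k\<bar> + \<omega>(8 \<epsilon>\<^sub>r) + \<delta>\<^sub>r)\<close> for all large \<open>r\<close>. The numbers \<open>\<delta>\<^sub>r\<close> and
  \<open>\<epsilon>\<^sub>r\<close> are free. If \<open>4\<^sup>r \<le> \<lambda>\<^sub>k\<close> from \<open>k = K\<^sub>r\<close> on, they are taken so small that
  \<open>\<delta>\<^sub>r\<close> and \<open>\<omega>(8 \<epsilon>\<^sub>r)\<close> are below \<open>1 / K\<^sub>r\<^sub>+\<^sub>1\<close>, and the bound with index \<open>r\<close> serves the frequencies
  \<open>K\<^sub>r \<le> \<bar>k\<bar> < K\<^sub>r\<^sub>+\<^sub>1\<close>.

  On the unit interval \<open>h\<close> satisfies a self-affine equation. One generation (\<open>stage\<close>) splits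
  the domain in the ratio \<open>b = 1 - \<delta>\<close> and the range in the ratio \<open>a = \<epsilon>\<close>, then halves all the
  parts, and puts a rescaled copy of the next map into each of the four pieces. The halving makes a
  generation a contraction by \<open>1/2\<close> for the uniform distance, whatever the ratios are, so the
  iteration converges (\<open>approx_Cauchy\<close>). Interchanging the roles of \<open>a\<close> and \<open>b\<close> yields the
  inverse map (\<open>limit_map_inverse\<close>), so injectivity comes for free. The self-affine equation also
  turns the Fourier estimate into an induction (\<open>osc_bounded_limit_map\<close>): rescaling an
  integral to a piece of length \<open>l\<close> multiplies both the frequency and
  the integral by \<open>l\<close>, so each piece contributes equally to the term \<open>A / \<bar>\<kappa>\<bar>\<close>, while the
  constant term is only
  averaged over the pieces.
\<close>

section \<open>Piecewise rescaled copies of a map of the unit interval\<close>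

definition end_fixing :: "(real \<Rightarrow> real) \<Rightarrow> bool" where
  "end_fixing \<phi> \<longleftrightarrow>
     continuous_on {0..1} \<phi> \<and> (\<forall>t\<in>{0..1}. \<phi> t \<in> {0..1}) \<and> \<phi> 0 = 0 \<and> \<phi> 1 = 1"

text \<open>
  The graph of \<open>split_map a b \<phi>\<close> consists of two affine copies of the graph of \<open>\<phi>\<close>, in the boxes
  \<open>[0, b] \<times> [0, a]\<close> and \<open>[b, 1] \<times> [a, 1]\<close>.
\<close>

definition split_map :: "real \<Rightarrow> real \<Rightarrow> (real \<Rightarrow> real) \<Rightarrow> real \<Rightarrow> real" where
  "split_map a b \<phi> t =
     (if t \<le> b then a * \<phi> (t / b) else a + (1 - a) * \<phi> ((t - b) / (1 - b)))"

lemma end_fixingD: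
  assumes "end_fixing \<phi>"
  shows "continuous_on {0..1} \<phi>" "\<And>t. 0 \<le> t \<Longrightarrow> t \<le> 1 \<Longrightarrow> 0 \<le> \<phi> t"
    "\<And>t. 0 \<le> t \<Longrightarrow> t \<le> 1 \<Longrightarrow> \<phi> t \<le> 1" "\<phi> 0 = 0" "\<phi> 1 = 1"
  using assms by (auto simp: end_fixing_def)

lemma end_fixing_id: "end_fixing (\<lambda>t. t)"
  by (auto simp: end_fixing_def)

lemma rescaled_arguments:
  fixes b t :: real
  assumes "0 < b" "b < 1" "0 \<le> t" "t \<le> 1"
  shows "t \<le> b \<Longrightarrow> 0 \<le> t / b \<and> t / b \<le> 1"
    and "b \<le> t \<Longrightarrow> 0 \<le> (t - b) / (1 - b) \<and> (t - b) / (1 - b) \<le> 1"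
  using assms by (auto simp: field_simps)

lemma affine_unit_interval:
  fixes a x :: real
  assumes "0 \<le> a" "a \<le> 1" "0 \<le> x" "x \<le> 1"
  shows "0 \<le> a * x" "a * x \<le> 1" "0 \<le> a + (1 - a) * x" "a + (1 - a) * x \<le> 1"
proof -
  have "0 \<le> (1 - a) * (1 - x)"
    using assms by auto
  then show "a + (1 - a) * x \<le> 1"
    by (simp add: algebra_simps)
qed (use assms in \<open>auto intro: mult_le_one\<close>)

lemma split_map_right:
  assumes "end_fixing \<phi>" "0 < b" "b < 1" "b \<le> t"
  shows "split_map a b \<phi> t = a + (1 - a) * \<phi> ((t - b) / (1 - b))"
  using assms by (cases "t = b") (auto simp: split_map_def end_fixing_def)

lemma end_fixing_split_map:
  assumes \<phi>: "end_fixing \<phi>" and a: "0 < a" "a < 1" and b: "0 < b" "b < 1"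
  shows "end_fixing (split_map a b \<phi>)"
  unfolding end_fixing_def
proof (intro conjI ballI)
  note D = end_fixingD[OF \<phi>]
  have L: "continuous_on {0..b} (\<lambda>t. a * \<phi> (t / b))"
    using b by (intro continuous_intros continuous_on_compose2[OF D(1)])
      (auto simp: field_simps)
  have R: "continuous_on {b..1} (\<lambda>t. a + (1 - a) * \<phi> ((t - b) / (1 - b)))"
    using b by (intro continuous_intros continuous_on_compose2[OF D(1)])
      (auto simp: field_simps)
  have "continuous_on ({0..b} \<union> {b..1}) (split_map a b \<phi>)"
  proof (rule continuous_on_closed_Un)
    show "continuous_on {0..b} (split_map a b \<phi>)"
      using L by (rule continuous_on_eq) (auto simp: split_map_def)
    show "continuous_on {b..1} (split_map a b \<phi>)"
      using R by (rule continuous_on_eq) (use split_map_right[OF \<phi> b] in auto)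
  qed auto
  moreover have "{0..b} \<union> {b..1} = {0..1}"
    using b by auto
  ultimately show "continuous_on {0..1} (split_map a b \<phi>)"
    by simp
  show "split_map a b \<phi> 0 = 0" "split_map a b \<phi> 1 = 1"
    using b D by (auto simp: split_map_def)
  fix t :: real assume t: "t \<in> {0..1}"
  show "split_map a b \<phi> t \<in> {0..1}"
  proof (cases "t \<le> b")
    case True
    then show ?thesis
      using affine_unit_interval(1,2)[of a "\<phi> (t / b)"] rescaled_arguments[OF b, of t] t D a
      by (auto simp: split_map_def)
  next
    case False
    then show ?thesis
      using affine_unit_interval(3,4)[of a "\<phi> ((t - b) / (1 - b))"]
        rescaled_arguments[OF b, of t] t D a
      by (auto simp: split_map_def)
  qed
qed

text \<open>
  Reflecting the graph in the diagonal interchanges the ratio of the range with that of the domain.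
\<close>

lemma split_map_left_inverse:
  assumes \<phi>: "end_fixing \<phi>" and \<psi>: "end_fixing \<psi>"
    and inv: "\<And>t. 0 \<le> t \<Longrightarrow> t \<le> 1 \<Longrightarrow> \<psi> (\<phi> t) = t"
    and a: "0 < a" "a < 1" and b: "0 < b" "b < 1" and t: "0 \<le> t" "t \<le> 1"
  shows "split_map b a \<psi> (split_map a b \<phi> t) = t"
proof (cases "t \<le> b")
  case True
  then have s: "0 \<le> t / b" "t / b \<le> 1"
    using rescaled_arguments[OF b t] by auto
  then have "a * \<phi> (t / b) \<le> a * 1"
    using end_fixingD[OF \<phi>] a by (intro mult_left_mono) auto
  then show ?thesis
    using True a b inv[OF s] by (simp add: split_map_def)
next
  case False
  then have s: "0 \<le> (t - b) / (1 - b)" "(t - b) / (1 - b) \<le> 1"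
    using rescaled_arguments[OF b t] by auto
  have "\<phi> ((t - b) / (1 - b)) \<noteq> 0"
  proof
    assume "\<phi> ((t - b) / (1 - b)) = 0"
    then have "(t - b) / (1 - b) = 0"
      using inv[OF s] end_fixingD(4)[OF \<psi>] by simp
    then show False
      using False b by auto
  qed
  then have "0 < (1 - a) * \<phi> ((t - b) / (1 - b))"
    using end_fixingD(2)[OF \<phi> s] a by auto
  then show ?thesis
    using False a b inv[OF s] by (simp add: split_map_def)
qed

text \<open>
  The vertical scale of the two copies is \<open>a\<close> and \<open>1 - a\<close>; the horizontal scale does not affect
  the uniform distance.
\<close>

lemma split_map_diff_le:
  assumes a: "0 < a" "a < 1" and b: "0 < b" "b < 1" and t: "0 \<le> t" "t \<le> 1"
    and c: "a \<le> c" "1 - a \<le> c"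
    and d: "\<And>s. 0 \<le> s \<Longrightarrow> s \<le> 1 \<Longrightarrow> \<bar>\<phi> s - \<psi> s\<bar> \<le> d"
  shows "\<bar>split_map a b \<phi> t - split_map a b \<psi> t\<bar> \<le> c * d"
proof (cases "t \<le> b")
  case True
  then have "\<bar>\<phi> (t / b) - \<psi> (t / b)\<bar> \<le> d"
    using rescaled_arguments[OF b t] by (intro d) auto
  then have "a * \<bar>\<phi> (t / b) - \<psi> (t / b)\<bar> \<le> c * d"
    using a c by (intro mult_mono) auto
  then show ?thesis
    using True a by (simp add: split_map_def abs_mult flip: right_diff_distrib)
next
  case False
  then have "\<bar>\<phi> ((t - b) / (1 - b)) - \<psi> ((t - b) / (1 - b))\<bar> \<le> d"
    using rescaled_arguments[OF b t] by (intro d) auto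
  then have "(1 - a) * \<bar>\<phi> ((t - b) / (1 - b)) - \<psi> ((t - b) / (1 - b))\<bar> \<le> c * d"
    using a c by (intro mult_mono) auto
  then show ?thesis
    using False a by (simp add: split_map_def abs_mult flip: right_diff_distrib)
qed

lemma split_map_tendsto:
  assumes "\<And>s. 0 \<le> s \<Longrightarrow> s \<le> 1 \<Longrightarrow> (\<lambda>n. \<phi> n s) \<longlonglongrightarrow> \<psi> s"
    and "0 < b" "b < 1" "0 \<le> t" "t \<le> 1"
  shows "(\<lambda>n. split_map a b (\<phi> n) t) \<longlonglongrightarrow> split_map a b \<psi> t"
  using rescaled_arguments[OF assms(2-5)] assms(1)
  by (cases "t \<le> b") (auto simp: split_map_def intro!: tendsto_intros)

section \<open>The limit homeomorphism of the unit interval\<close>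

text \<open>
  The inner, even splitting ensures that no piece is longer than half of the interval, in the domain
  or in the range, however uneven the outer splitting is.
\<close>

definition stage :: "real \<Rightarrow> real \<Rightarrow> (real \<Rightarrow> real) \<Rightarrow> real \<Rightarrow> real" where
  "stage a b \<phi> = split_map a b (split_map (1/2) (1/2) \<phi>)"

primrec approx :: "(nat \<Rightarrow> real) \<Rightarrow> (nat \<Rightarrow> real) \<Rightarrow> nat \<Rightarrow> nat \<Rightarrow> real \<Rightarrow> real" where
  "approx a b 0 m = (\<lambda>t. t)"
| "approx a b (Suc n) m = stage (a m) (b m) (approx a b n (Suc m))"

text \<open>
  The index \<open>m\<close> is the number of the first generation, so that \<open>limit_map a b (Suc m)\<close> is the map of
  which \<open>limit_map a b m\<close> contains four copies.
\<close>

definition limit_map :: "(nat \<Rightarrow> real) \<Rightarrow> (nat \<Rightarrow> real) \<Rightarrow> nat \<Rightarrow> real \<Rightarrow> real" where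
  "limit_map a b m t = lim (\<lambda>n. approx a b n m t)"

lemma end_fixing_stage:
  assumes "end_fixing \<phi>" "0 < a" "a < 1" "0 < b" "b < 1"
  shows "end_fixing (stage a b \<phi>)"
  unfolding stage_def using assms by (intro end_fixing_split_map) auto

locale ratios =
  fixes a b :: "nat \<Rightarrow> real"
  assumes a: "0 < a m" "a m < 1" and b: "0 < b m" "b m < 1"
begin

lemma end_fixing_approx: "end_fixing (approx a b n m)"
  by (induction n arbitrary: m) (auto intro: end_fixing_id end_fixing_stage a b)

text \<open>
  The two approximations share their first \<open>n\<close> generations, each of which is a contraction by \<open>1/2\<close>;
  below them there are two maps of the unit interval into itself.
\<close>

lemma approx_Cauchy:
  assumes "0 \<le> t" "t \<le> 1"
  shows "\<bar>approx a b (n + p) m t - approx a b n m t\<bar> \<le> (1/2) ^ n"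
  using assms
proof (induction n arbitrary: m t)
  case 0
  then show ?case
    using end_fixingD(2,3)[OF end_fixing_approx[of p m], of t] by auto
next
  case (Suc n)
  have "\<bar>stage (a m) (b m) (approx a b (n + p) (Suc m)) t
      - stage (a m) (b m) (approx a b n (Suc m)) t\<bar> \<le> 1 * (1/2 * (1/2) ^ n)"
    unfolding stage_def using Suc.prems a[of m] b[of m]
    by (intro split_map_diff_le[where c = 1] split_map_diff_le[where c = "1/2"] Suc.IH) auto
  then show ?case
    by simp
qed

lemma approx_tendsto:
  assumes t: "0 \<le> t" "t \<le> 1"
  shows "(\<lambda>n. approx a b n m t) \<longlonglongrightarrow> limit_map a b m t"
proof -
  have "Cauchy (\<lambda>n. approx a b n m t)"
  proof (rule CauchyI')
    fix e :: real assume "0 < e"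
    then obtain M :: nat where M: "(1/2 :: real) ^ M < e"
      using real_arch_pow_inv[of e "1/2"] by auto
    have "dist (approx a b k m t) (approx a b n m t) < e" if "M \<le> k" "k < n" for k n
    proof -
      have "\<bar>approx a b (k + (n - k)) m t - approx a b k m t\<bar> \<le> (1/2) ^ k"
        by (rule approx_Cauchy[OF t])
      also have "\<dots> \<le> (1/2) ^ M"
        using that by (intro power_decreasing) auto
      finally show ?thesis
        using M that by (simp add: dist_real_def)
    qed
    then show "\<exists>M. \<forall>k\<ge>M. \<forall>n>k. dist (approx a b k m t) (approx a b n m t) < e"
      by blast
  qed
  then show ?thesis
    unfolding limit_map_def using Cauchy_convergent_iff convergent_LIMSEQ_iff by blast
qed

lemma limit_map_approx_le:
  assumes t: "0 \<le> t" "t \<le> 1"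
  shows "\<bar>limit_map a b m t - approx a b n m t\<bar> \<le> (1/2) ^ n"
proof (rule LIMSEQ_le_const2)
  show "(\<lambda>p. \<bar>approx a b (n + p) m t - approx a b n m t\<bar>)
      \<longlonglongrightarrow> \<bar>limit_map a b m t - approx a b n m t\<bar>"
    using LIMSEQ_ignore_initial_segment[OF approx_tendsto[OF t, of m], of n]
    by (intro tendsto_intros) (simp add: add.commute)
  show "\<exists>N. \<forall>p\<ge>N. \<bar>approx a b (n + p) m t - approx a b n m t\<bar> \<le> (1/2) ^ n"
    using approx_Cauchy[OF t] by blast
qed

lemma uniform_limit_approx:
  "uniform_limit {0..1} (\<lambda>n. approx a b n m) (limit_map a b m) sequentially"
proof (rule uniform_limitI)
  fix e :: real assume "0 < e"
  then have "\<forall>\<^sub>F n in sequentially. (1/2 :: real) ^ n < e"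
    by (intro order_tendstoD(2)[of _ 0] LIMSEQ_power_zero) auto
  then show "\<forall>\<^sub>F n in sequentially. \<forall>t\<in>{0..1}. dist (approx a b n m t) (limit_map a b m t) < e"
  proof eventually_elim
    case (elim n)
    show ?case
      using le_less_trans[OF limit_map_approx_le elim]
      by (auto simp: dist_real_def abs_minus_commute)
  qed
qed

lemma end_fixing_limit_map: "end_fixing (limit_map a b m)"
  unfolding end_fixing_def
proof (intro conjI ballI)
  note D = end_fixingD[OF end_fixing_approx]
  show "continuous_on {0..1} (limit_map a b m)"
    by (rule uniform_limit_theorem[OF _ uniform_limit_approx]) (auto intro: D always_eventually)
  show "limit_map a b m 0 = 0" "limit_map a b m 1 = 1"
    by (simp_all add: limit_map_def D)
  fix t :: real assume t: "t \<in> {0..1}"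
  have "0 \<le> limit_map a b m t"
    by (rule LIMSEQ_le_const[OF approx_tendsto]) (use t D in auto)
  moreover have "limit_map a b m t \<le> 1"
    by (rule LIMSEQ_le_const2[OF approx_tendsto]) (use t D in auto)
  ultimately show "limit_map a b m t \<in> {0..1}"
    by simp
qed

lemma limit_map_stage:
  assumes t: "0 \<le> t" "t \<le> 1"
  shows "limit_map a b m t = stage (a m) (b m) (limit_map a b (Suc m)) t"
proof (rule LIMSEQ_unique)
  show "(\<lambda>n. approx a b (Suc n) m t) \<longlonglongrightarrow> limit_map a b m t"
    using approx_tendsto[OF t] by (rule LIMSEQ_Suc)
  show "(\<lambda>n. approx a b (Suc n) m t) \<longlonglongrightarrow> stage (a m) (b m) (limit_map a b (Suc m)) t"
    unfolding approx.simps stage_def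
    by (intro split_map_tendsto approx_tendsto b t) auto
qed

end

text \<open>
  The identity holds at every finite generation and passes to the limit, because the approximations
  of the outer map converge uniformly.
\<close>

lemma limit_map_inverse:
  assumes "ratios a b" and t: "0 \<le> t" "t \<le> 1"
  shows "limit_map b a m (limit_map a b m t) = t"
proof -
  interpret ratios a b by fact
  interpret swapped: ratios b a
    using a b by unfold_locales
  have inv: "approx b a n m (approx a b n m s) = s" if "0 \<le> s" "s \<le> 1" for n m s
    using that
  proof (induction n arbitrary: m s)
    case (Suc n)
    show ?case
      unfolding approx.simps stage_def
      by (intro split_map_left_inverse end_fixing_split_map
          end_fixing_approx swapped.end_fixing_approx a b Suc.IH Suc.prems)
        (use Suc.prems in auto)
  qed simp
  have conv: "(\<lambda>n. limit_map b a m (approx a b n m t) - approx b a n m (approx a b n m t)) \<longlonglongrightarrow> 0"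
  proof (rule Lim_null_comparison)
    show "\<forall>\<^sub>F n in sequentially. norm (limit_map b a m (approx a b n m t)
        - approx b a n m (approx a b n m t)) \<le> (1/2) ^ n"
      using swapped.limit_map_approx_le end_fixingD(2,3)[OF end_fixing_approx t] by simp
  qed (auto intro: LIMSEQ_power_zero)
  have cont: "(\<lambda>n. limit_map b a m (approx a b n m t)) \<longlonglongrightarrow> limit_map b a m (limit_map a b m t)"
    by (rule continuous_on_tendsto_compose[OF end_fixingD(1)[OF swapped.end_fixing_limit_map]
          approx_tendsto[OF t]])
      (use end_fixingD(2,3)[OF end_fixing_approx t] end_fixingD(2,3)[OF end_fixing_limit_map t] in auto)
  have "(\<lambda>n. approx b a n m (approx a b n m t)) \<longlonglongrightarrow> limit_map b a m (limit_map a b m t)"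
    using tendsto_diff[OF cont conv] by simp
  then show ?thesis
    by (simp add: inv[OF t] LIMSEQ_const_iff)
qed

section \<open>Oscillatory integrals\<close>

definition osc_integral :: "(real \<Rightarrow> real) \<Rightarrow> real \<Rightarrow> complex" where
  "osc_integral g \<kappa> = integral {0..1} (\<lambda>t. of_real (g t) * cis (\<kappa> * t))"

text \<open>
  These classes are invariant under restriction to a subinterval followed by rescaling to the unit
  interval (\<open>test_functions_affine\<close>), which only makes a function vary more slowly. This is what an
  induction over the generations needs.
\<close>

definition test_functions :: "real \<Rightarrow> real \<Rightarrow> real \<Rightarrow> (real \<Rightarrow> real) set" where
  "test_functions M \<epsilon> \<eta> = {f. continuous_on {0..1} f \<and> (\<forall>x\<in>{0..1}. \<bar>f x\<bar> \<le> M) \<and>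
     (\<forall>x\<in>{0..1}. \<forall>y\<in>{0..1}. \<bar>x - y\<bar> \<le> \<epsilon> \<longrightarrow> \<bar>f x - f y\<bar> \<le> \<eta>)}"

lemma test_functions_affine:
  assumes f: "f \<in> test_functions M \<epsilon> \<eta>" and "0 \<le> c" "0 \<le> l" "c + l \<le> 1"
  shows "(\<lambda>x. f (c + l * x)) \<in> test_functions M \<epsilon> \<eta>"
proof -
  have im: "0 \<le> c + l * x" "c + l * x \<le> 1" if "0 \<le> x" "x \<le> 1" for x
    using assms that mult_left_mono[of x 1 l] by (auto intro: add_nonneg_nonneg)
  have "\<bar>(c + l * x) - (c + l * y)\<bar> \<le> \<epsilon>" if "\<bar>x - y\<bar> \<le> \<epsilon>" for x y
  proof -
    have "\<bar>(c + l * x) - (c + l * y)\<bar> = l * \<bar>x - y\<bar>"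
      using assms by (simp add: abs_mult flip: right_diff_distrib)
    also have "\<dots> \<le> 1 * \<epsilon>"
      using assms that by (intro mult_mono) auto
    finally show ?thesis by simp
  qed
  moreover have "continuous_on {0..1} f"
    using f by (simp add: test_functions_def)
  then have "continuous_on {0..1} (\<lambda>x. f (c + l * x))"
    by (rule continuous_on_compose2) (use im in \<open>auto intro!: continuous_intros\<close>)
  ultimately show ?thesis
    using f im by (auto simp: test_functions_def)
qed

lemma integral_rescale:
  fixes g :: "real \<Rightarrow> complex"
  assumes "0 < l" "continuous_on {0..1} g"
  shows "((\<lambda>t. g ((t - c) / l)) has_integral of_real l * integral {0..1} g) {c..c + l}"
proof -
  have "(g has_integral integral {0..1} g) (cbox 0 1)"
    using assms integrable_continuous_real integrable_integral by fastforce
  then have "((\<lambda>t. g ((1 / l) *\<^sub>R t + - c / l)) has_integral integral {0..1} g /\<^sub>R (1 / l) ^ DIM(real))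
      (cbox ((0 - - c / l) /\<^sub>R (1 / l)) ((1 - - c / l) /\<^sub>R (1 / l)))"
    using assms by (intro has_integral_affinity') auto
  moreover have "(1 / l) *\<^sub>R t + - c / l = (t - c) / l" for t
    by (simp add: diff_divide_distrib)
  moreover have "(0 - - c / l) /\<^sub>R (1 / l) = c" "(1 - - c / l) /\<^sub>R (1 / l) = c + l"
    using assms by (simp_all add: distrib_left)
  ultimately show ?thesis
    unfolding cbox_interval by (simp add: scaleR_conv_of_real)
qed

lemma osc_integral_split_map:
  assumes \<phi>: "end_fixing \<phi>" and a: "0 < a" "a < 1" and b: "0 < b" "b < 1"
    and f: "continuous_on {0..1} f"
  shows "osc_integral (\<lambda>t. f (split_map a b \<phi> t)) \<kappa> =
    of_real b * osc_integral (\<lambda>t. f (0 + a * \<phi> t)) (\<kappa> * b) +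
    of_real (1 - b) * cis (\<kappa> * b) * osc_integral (\<lambda>t. f (a + (1 - a) * \<phi> t)) (\<kappa> * (1 - b))"
proof -
  note D = end_fixingD[OF \<phi>]
  have im: "a + (1 - a) * \<phi> t \<le> 1" "a * \<phi> t \<le> 1" if "0 \<le> t" "t \<le> 1" for t
    using affine_unit_interval[of a "\<phi> t"] D(2,3)[OF that] a by auto
  let ?L = "\<lambda>t. of_real (f (0 + a * \<phi> t)) * cis (\<kappa> * b * t)"
  let ?R = "\<lambda>t. of_real (f (a + (1 - a) * \<phi> t)) * cis (\<kappa> * (1 - b) * t)"
  let ?F = "\<lambda>t. of_real (f (split_map a b \<phi> t)) * cis (\<kappa> * t)"
  have cont: "continuous_on {0..1} ?L" "continuous_on {0..1} ?R"
    using D im a by (auto intro!: continuous_intros continuous_on_compose2[OF f])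
  have "(?F has_integral of_real b * integral {0..1} ?L) {0..0 + b}"
    by (rule has_integral_eq[OF _ integral_rescale[OF b(1) cont(1), of 0]])
      (use b in \<open>auto simp: split_map_def\<close>)
  moreover have "(?F has_integral cis (\<kappa> * b) * (of_real (1 - b) * integral {0..1} ?R)) {b..b + (1 - b)}"
  proof (rule has_integral_eq[OF _ has_integral_mult_right[OF integral_rescale[OF _ cont(2), of _ b]]])
    fix t assume "t \<in> {b..b + (1 - b)}"
    moreover have "cis (\<kappa> * b) * cis (\<kappa> * (1 - b) * ((t - b) / (1 - b))) = cis (\<kappa> * t)"
      using b by (simp add: cis_mult flip: distrib_left)
    ultimately show "cis (\<kappa> * b) * (of_real (f (a + (1 - a) * \<phi> ((t - b) / (1 - b)))) *
        cis (\<kappa> * (1 - b) * ((t - b) / (1 - b)))) = ?F t"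
      using split_map_right[OF \<phi> b, of t a] by (simp add: mult.left_commute)
  qed (use b in auto)
  ultimately have "(?F has_integral (of_real b * integral {0..1} ?L +
      cis (\<kappa> * b) * (of_real (1 - b) * integral {0..1} ?R))) {0..1}"
    using b by (intro has_integral_combine[of 0 b 1]) auto
  then show ?thesis
    unfolding osc_integral_def by (simp add: integral_unique mult_ac)
qed

text \<open>
  The part \<open>A\<close> of the bound grows with the number of pieces on which \<open>f \<circ> \<phi>\<close> is nearly constant; the
  part \<open>B\<close> is the mean distance from a step function. All frequencies are included, because
  rescaling changes them.
\<close>

definition osc_bounded :: "(real \<Rightarrow> real) \<Rightarrow> (real \<Rightarrow> real) set \<Rightarrow> real \<Rightarrow> real \<Rightarrow> bool" where
  "osc_bounded \<phi> \<F> A B \<longleftrightarrow>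
     (\<forall>f\<in>\<F>. \<forall>\<kappa>. \<kappa> \<noteq> 0 \<longrightarrow> norm (osc_integral (\<lambda>t. f (\<phi> t)) \<kappa>) \<le> A / \<bar>\<kappa>\<bar> + B)"

lemma osc_boundedD:
  assumes "osc_bounded \<phi> \<F> A B" "f \<in> \<F>" "\<kappa> \<noteq> 0"
  shows "norm (osc_integral (\<lambda>t. f (\<phi> t)) \<kappa>) \<le> A / \<bar>\<kappa>\<bar> + B"
  using assms by (simp add: osc_bounded_def)

text \<open>
  The two copies have lengths \<open>b\<close> and \<open>1 - b\<close> and see the frequencies \<open>\<kappa> b\<close> and \<open>\<kappa> (1 - b)\<close>. Hence
  \<open>b (A / \<bar>\<kappa> b\<bar> + B) + (1 - b) (A / \<bar>\<kappa> (1 - b)\<bar> + B) = 2 A / \<bar>\<kappa>\<bar> + B\<close>: the first part doubles and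
  the second stays.
\<close>

lemma osc_bounded_split_map:
  assumes \<phi>: "end_fixing \<phi>" and a: "0 < a" "a < 1" and b: "0 < b" "b < 1"
    and bd: "osc_bounded \<phi> (test_functions M \<epsilon> \<eta>) A B"
  shows "osc_bounded (split_map a b \<phi>) (test_functions M \<epsilon> \<eta>) (2 * A) B"
  unfolding osc_bounded_def
proof (intro ballI allI impI)
  fix f and \<kappa> :: real assume f: "f \<in> test_functions M \<epsilon> \<eta>" and \<kappa>: "\<kappa> \<noteq> 0"
  have "norm (osc_integral (\<lambda>t. f (0 + a * \<phi> t)) (\<kappa> * b)) \<le> A / \<bar>\<kappa> * b\<bar> + B"
    by (rule osc_boundedD[OF bd test_functions_affine[OF f]])
      (use a b \<kappa> in auto)
  moreover have "norm (osc_integral (\<lambda>t. f (a + (1 - a) * \<phi> t)) (\<kappa> * (1 - b)))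
      \<le> A / \<bar>\<kappa> * (1 - b)\<bar> + B"
    by (rule osc_boundedD[OF bd test_functions_affine[OF f]])
      (use a b \<kappa> in auto)
  ultimately have "b * norm (osc_integral (\<lambda>t. f (0 + a * \<phi> t)) (\<kappa> * b)) +
      (1 - b) * norm (osc_integral (\<lambda>t. f (a + (1 - a) * \<phi> t)) (\<kappa> * (1 - b)))
      \<le> b * (A / \<bar>\<kappa> * b\<bar> + B) + (1 - b) * (A / \<bar>\<kappa> * (1 - b)\<bar> + B)"
    using b by (intro add_mono mult_left_mono) auto
  also have "\<dots> = 2 * A / \<bar>\<kappa>\<bar> + B"
  proof -
    have cancel: "x * (A / \<bar>\<kappa> * x\<bar>) = A / \<bar>\<kappa>\<bar>" if "0 < x" for x
      using that by (simp add: abs_mult)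
    have convex: "x * (p + B) + (1 - x) * (q + B) = x * p + (1 - x) * q + B" for x p q
      by (simp add: algebra_simps)
    show ?thesis
      unfolding convex using cancel[of b] cancel[of "1 - b"] b by simp
  qed
  finally have le: "b * norm (osc_integral (\<lambda>t. f (0 + a * \<phi> t)) (\<kappa> * b)) +
      (1 - b) * norm (osc_integral (\<lambda>t. f (a + (1 - a) * \<phi> t)) (\<kappa> * (1 - b)))
      \<le> 2 * A / \<bar>\<kappa>\<bar> + B" .
  have cont: "continuous_on {0..1} f"
    using f by (simp add: test_functions_def)
  have "norm (osc_integral (\<lambda>t. f (split_map a b \<phi> t)) \<kappa>) \<le>
      norm (of_real b * osc_integral (\<lambda>t. f (0 + a * \<phi> t)) (\<kappa> * b)) +
      norm (of_real (1 - b) * cis (\<kappa> * b) * osc_integral (\<lambda>t. f (a + (1 - a) * \<phi> t)) (\<kappa> * (1 - b)))"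
    unfolding osc_integral_split_map[OF \<phi> a b cont] by (rule norm_triangle_ineq)
  also have "\<dots> = b * norm (osc_integral (\<lambda>t. f (0 + a * \<phi> t)) (\<kappa> * b)) +
      (1 - b) * norm (osc_integral (\<lambda>t. f (a + (1 - a) * \<phi> t)) (\<kappa> * (1 - b)))"
    using b unfolding norm_mult norm_of_real by simp
  also note le
  finally show "norm (osc_integral (\<lambda>t. f (split_map a b \<phi> t)) \<kappa>) \<le> 2 * A / \<bar>\<kappa>\<bar> + B" .
qed

lemma norm_integral_cis_le:
  assumes "\<kappa> \<noteq> 0" "0 \<le> c"
  shows "norm (integral {0..c} (\<lambda>t. cis (\<kappa> * t))) \<le> 2 / \<bar>\<kappa>\<bar>"
proof -
  have "((\<lambda>z. exp (\<i> * of_real \<kappa> * z) / (\<i> * of_real \<kappa>))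
      has_field_derivative exp (\<i> * of_real \<kappa> * z)) (at z)" for z
    using assms by (auto intro!: derivative_eq_intros)
  then have "((\<lambda>t. exp (\<i> * of_real \<kappa> * of_real t) / (\<i> * of_real \<kappa>))
      has_vector_derivative exp (\<i> * of_real \<kappa> * of_real t)) (at t within {0..c})" for t
    by (rule has_vector_derivative_real_field)
  then have "((\<lambda>t. cis (\<kappa> * t)) has_integral
      (cis (\<kappa> * c) / (\<i> * of_real \<kappa>) - cis (\<kappa> * 0) / (\<i> * of_real \<kappa>))) {0..c}"
    using assms by (intro fundamental_theorem_of_calculus) (auto simp: cis_conv_exp mult.assoc)
  moreover have "norm (cis (\<kappa> * c) / (\<i> * of_real \<kappa>) - cis (\<kappa> * 0) / (\<i> * of_real \<kappa>))
      \<le> 1 / \<bar>\<kappa>\<bar> + 1 / \<bar>\<kappa>\<bar>"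
    by (rule order_trans[OF norm_triangle_ineq4]) (simp add: norm_divide norm_mult)
  ultimately show ?thesis
    by (simp add: integral_unique)
qed

text \<open>
  On \<open>[0, b]\<close> the map stays within \<open>[0, a]\<close>, so that the test function can be replaced by its
  value at \<open>0\<close> with an error of \<open>\<eta>\<close>; the rest of the interval has length \<open>1 - b\<close>.
\<close>

lemma osc_bounded_concentrated:
  assumes \<psi>: "end_fixing \<psi>" and a: "0 < a" "a < 1" and b: "0 < b" "b < 1"
    and "a \<le> \<epsilon>" "0 \<le> \<eta>"
  shows "osc_bounded (split_map a b \<psi>) (test_functions M \<epsilon> \<eta>) (2 * M) (\<eta> + M * (1 - b))"
  unfolding osc_bounded_def
proof (intro ballI allI impI)
  fix f and \<kappa> :: real assume f: "f \<in> test_functions M \<epsilon> \<eta>" and \<kappa>: "\<kappa> \<noteq> 0"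
  define \<phi> where "\<phi> = split_map a b \<psi>"
  have \<phi>: "end_fixing \<phi>"
    unfolding \<phi>_def by (rule end_fixing_split_map) fact+
  note D = end_fixingD[OF \<phi>]
  have f': "continuous_on {0..1} f" "\<And>x. x \<in> {0..1} \<Longrightarrow> \<bar>f x\<bar> \<le> M"
    "\<And>x y. x \<in> {0..1} \<Longrightarrow> y \<in> {0..1} \<Longrightarrow> \<bar>x - y\<bar> \<le> \<epsilon> \<Longrightarrow> \<bar>f x - f y\<bar> \<le> \<eta>"
    using f by (auto simp: test_functions_def)
  let ?F = "\<lambda>t. of_real (f (\<phi> t)) * cis (\<kappa> * t)"
  have cont: "continuous_on {0..1} ?F"
    using D by (intro continuous_intros continuous_on_compose2[OF f'(1)]) auto
  have int: "?F integrable_on {0..1}" "?F integrable_on {0..b}" "?F integrable_on {b..1}"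
    by (rule integrable_continuous_real, rule continuous_on_subset[OF cont], use b in auto)+
  have icis: "(\<lambda>t. of_real (f 0) * cis (\<kappa> * t)) integrable_on {0..b}"
    by (intro integrable_continuous_real continuous_intros)
  have "norm (integral {0..b} (\<lambda>t. ?F t - of_real (f 0) * cis (\<kappa> * t))) \<le> \<eta> * (b - 0)"
  proof (rule integral_bound)
    show "continuous_on {0..b} (\<lambda>t. ?F t - of_real (f 0) * cis (\<kappa> * t))"
      using b by (intro continuous_intros continuous_on_subset[OF cont]) auto
    fix t assume t: "t \<in> {0..b}"
    then have "0 \<le> t / b" "t / b \<le> 1"
      using b by (auto simp: field_simps)
    then have "\<phi> t \<in> {0..a}"
      using t a end_fixingD(2,3)[OF \<psi>, of "t / b"] mult_left_mono[of "\<psi> (t / b)" 1 a]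
      by (auto simp: \<phi>_def split_map_def)
    then have "\<bar>f (\<phi> t) - f 0\<bar> \<le> \<eta>"
      using a assms by (intro f'(3)) auto
    then show "norm (?F t - of_real (f 0) * cis (\<kappa> * t)) \<le> \<eta>"
      by (simp add: norm_mult flip: left_diff_distrib of_real_diff)
  qed (use b in auto)
  also have "\<eta> * (b - 0) \<le> \<eta>"
    using b assms by (simp add: mult_left_le)
  finally have "norm (integral {0..b} ?F - of_real (f 0) * integral {0..b} (\<lambda>t. cis (\<kappa> * t))) \<le> \<eta>"
    using integral_diff[OF int(2) icis] by simp
  moreover have "norm (of_real (f 0) * integral {0..b} (\<lambda>t. cis (\<kappa> * t))) \<le> M * (2 / \<bar>\<kappa>\<bar>)"
    unfolding norm_mult using norm_integral_cis_le[OF \<kappa>, of b] f'(2)[of 0] b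
    by (intro mult_mono) auto
  ultimately have left: "norm (integral {0..b} ?F) \<le> M * (2 / \<bar>\<kappa>\<bar>) + \<eta>"
    using norm_triangle_sub[of "integral {0..b} ?F" "of_real (f 0) * integral {0..b} (\<lambda>t. cis (\<kappa> * t))"]
    by linarith
  have right: "norm (integral {b..1} ?F) \<le> M * (1 - b)"
    using b D f'(2) by (intro integral_bound continuous_on_subset[OF cont]) (auto simp: norm_mult)
  have "integral {0..1} ?F = integral {0..b} ?F + integral {b..1} ?F"
    using b int by (intro Henstock_Kurzweil_Integration.integral_combine[symmetric]) auto
  then have "norm (osc_integral (\<lambda>t. f (\<phi> t)) \<kappa>) \<le> norm (integral {0..b} ?F) + norm (integral {b..1} ?F)"
    unfolding osc_integral_def by (simp only: norm_triangle_ineq)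
  also have "\<dots> \<le> (M * (2 / \<bar>\<kappa>\<bar>) + \<eta>) + M * (1 - b)"
    using left right by (rule add_mono)
  also have "\<dots> = 2 * M / \<bar>\<kappa>\<bar> + (\<eta> + M * (1 - b))"
    by (simp only: add.assoc times_divide_eq_right mult.commute)
  finally show "norm (osc_integral (\<lambda>t. f (split_map a b \<psi> t)) \<kappa>) \<le> 2 * M / \<bar>\<kappa>\<bar> + (\<eta> + M * (1 - b))"
    by (simp only: \<phi>_def)
qed

lemma osc_bounded_cong:
  assumes "\<And>t. 0 \<le> t \<Longrightarrow> t \<le> 1 \<Longrightarrow> \<phi> t = \<psi> t" and bd: "osc_bounded \<psi> \<F> A B"
  shows "osc_bounded \<phi> \<F> A B"
  unfolding osc_bounded_def
proof (intro ballI allI impI)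
  fix f and \<kappa> :: real assume "f \<in> \<F>" "\<kappa> \<noteq> 0"
  then have "norm (osc_integral (\<lambda>t. f (\<psi> t)) \<kappa>) \<le> A / \<bar>\<kappa>\<bar> + B"
    by (rule osc_boundedD[OF bd])
  moreover have "osc_integral (\<lambda>t. f (\<phi> t)) \<kappa> = osc_integral (\<lambda>t. f (\<psi> t)) \<kappa>"
    unfolding osc_integral_def by (intro integral_cong) (simp add: assms(1))
  ultimately show "norm (osc_integral (\<lambda>t. f (\<phi> t)) \<kappa>) \<le> A / \<bar>\<kappa>\<bar> + B"
    by simp
qed

text \<open>
  Generation \<open>m + r\<close> provides the concentration, and each of the \<open>r\<close> generations above it splits
  the interval twice, which gives the factor \<open>4 ^ r\<close>.
\<close>

lemma (in ratios) osc_bounded_limit_map: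
  assumes "a (m + r) \<le> \<epsilon>" "0 \<le> \<eta>"
  shows "osc_bounded (limit_map a b m) (test_functions M \<epsilon> \<eta>)
    (4 ^ r * (2 * M)) (\<eta> + M * (1 - b (m + r)))"
  using assms
proof (induction r arbitrary: m)
  case 0
  have "osc_bounded (stage (a m) (b m) (limit_map a b (Suc m))) (test_functions M \<epsilon> \<eta>)
      (2 * M) (\<eta> + M * (1 - b m))"
    unfolding stage_def using 0 a b
    by (intro osc_bounded_concentrated end_fixing_split_map end_fixing_limit_map) auto
  then have "osc_bounded (limit_map a b m) (test_functions M \<epsilon> \<eta>) (2 * M) (\<eta> + M * (1 - b m))"
    by (rule osc_bounded_cong[rotated]) (rule limit_map_stage)
  then show ?case
    by simp
next
  case (Suc r)
  have "osc_bounded (stage (a m) (b m) (limit_map a b (Suc m))) (test_functions M \<epsilon> \<eta>)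
      (2 * (2 * (4 ^ r * (2 * M)))) (\<eta> + M * (1 - b (Suc m + r)))"
    unfolding stage_def using Suc.IH[of "Suc m"] Suc.prems a b
    by (intro osc_bounded_split_map end_fixing_split_map end_fixing_limit_map) auto
  then have "osc_bounded (limit_map a b m) (test_functions M \<epsilon> \<eta>)
      (2 * (2 * (4 ^ r * (2 * M)))) (\<eta> + M * (1 - b (Suc m + r)))"
    by (rule osc_bounded_cong[rotated]) (rule limit_map_stage)
  then show ?case
    by (simp add: mult.assoc)
qed

section \<open>Homeomorphisms of the circle\<close>

text \<open>
  The extension of \<open>\<phi>\<close> to the line that commutes with integer translations, as needed for a map
  of \<open>\<real> / \<int>\<close>.
\<close>

definition degree_one_lift :: "(real \<Rightarrow> real) \<Rightarrow> real \<Rightarrow> real" where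
  "degree_one_lift \<phi> x = of_int \<lfloor>x\<rfloor> + \<phi> (frac x)"

lemma degree_one_lift_add_int: "degree_one_lift \<phi> (x + of_int n) = degree_one_lift \<phi> x + of_int n"
  by (simp add: degree_one_lift_def frac_def)

lemma degree_one_lift_unit_interval:
  assumes "end_fixing \<phi>" "0 \<le> x" "x \<le> 1"
  shows "degree_one_lift \<phi> x = \<phi> x"
proof (cases "x = 1")
  case False
  then have "\<lfloor>x\<rfloor> = 0"
    using assms by (simp add: floor_eq_iff)
  then show ?thesis
    by (simp add: degree_one_lift_def frac_def)
qed (use assms in \<open>simp add: degree_one_lift_def end_fixing_def\<close>)

lemma continuous_degree_one_lift:
  assumes \<phi>: "end_fixing \<phi>"
  shows "continuous_on UNIV (degree_one_lift \<phi>)"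
proof -
  have unit: "continuous_on {of_int n..of_int n + 1} (degree_one_lift \<phi>)" for n :: int
  proof (rule continuous_on_eq)
    show "continuous_on {of_int n..of_int n + 1} (\<lambda>x. \<phi> (x - of_int n) + of_int n)"
      by (intro continuous_intros continuous_on_compose2[OF end_fixingD(1)[OF \<phi>]]) auto
    show "\<phi> (x - of_int n) + of_int n = degree_one_lift \<phi> x" if "x \<in> {of_int n..of_int n + 1}" for x
      using that degree_one_lift_add_int[of \<phi> "x - of_int n" n]
        degree_one_lift_unit_interval[OF \<phi>, of "x - of_int n"] by simp
  qed
  have "isCont (degree_one_lift \<phi>) x" for x
  proof (rule continuous_on_interior)
    have "continuous_on ({of_int (\<lfloor>x\<rfloor> - 1)..of_int (\<lfloor>x\<rfloor> - 1) + 1} \<union> {of_int \<lfloor>x\<rfloor>..of_int \<lfloor>x\<rfloor> + 1})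
        (degree_one_lift \<phi>)"
      by (intro continuous_on_closed_Un unit) auto
    then show "continuous_on {of_int \<lfloor>x\<rfloor> - 1..of_int \<lfloor>x\<rfloor> + 1} (degree_one_lift \<phi>)"
      by (rule continuous_on_subset) auto
    show "x \<in> interior {of_int \<lfloor>x\<rfloor> - 1..of_int \<lfloor>x\<rfloor> + 1}"
      by simp linarith
  qed
  then show ?thesis
    by (simp add: continuous_on_eq_continuous_within)
qed

text \<open>
  It suffices to compute on one period, because the lifts commute with integer translations.
\<close>

lemma degree_one_lift_inverse:
  assumes \<phi>: "end_fixing \<phi>" and \<psi>: "end_fixing \<psi>"
    and inv: "\<And>t. 0 \<le> t \<Longrightarrow> t \<le> 1 \<Longrightarrow> \<psi> (\<phi> t) = t"
  shows "degree_one_lift \<psi> (degree_one_lift \<phi> x) = x"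
proof -
  have fr: "0 \<le> frac x" "frac x < 1"
    by (auto simp: frac_lt_1)
  then have "degree_one_lift \<psi> (\<phi> (frac x)) = frac x"
    using inv[of "frac x"] end_fixingD(2,3)[OF \<phi>, of "frac x"] degree_one_lift_unit_interval[OF \<psi>]
    by simp
  then have "degree_one_lift \<psi> (\<phi> (frac x) + of_int \<lfloor>x\<rfloor>) = frac x + of_int \<lfloor>x\<rfloor>"
    by (simp add: degree_one_lift_add_int)
  then show ?thesis
    by (simp add: degree_one_lift_def[of \<phi>] add.commute frac_def)
qed

lemma circle_of_eq_iff: "circle_of s = circle_of t \<longleftrightarrow> (\<exists>n::int. t = s + of_int n * (2 * pi))"
  by (simp add: circle.abs_eq_iff rcong_altdef)

lemma circle_of_circle_rep: "circle_of (circle_rep c) = c"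
  using Quotient_abs_rep[OF Quotient_circle] .

lemma continuous_circle_of: "continuous_on UNIV circle_of"
  by (simp add: continuous_on_open_vimage open_circle_def)

definition circle_map :: "(real \<Rightarrow> real) \<Rightarrow> circle \<Rightarrow> circle" where
  "circle_map \<phi> c = circle_of (2 * pi * degree_one_lift \<phi> (circle_rep c / (2 * pi)))"

lemma circle_map_circle_of:
  "circle_map \<phi> (circle_of s) = circle_of (2 * pi * degree_one_lift \<phi> (s / (2 * pi)))"
proof -
  have "circle_of s = circle_of (circle_rep (circle_of s))"
    by (simp add: circle_of_circle_rep)
  then obtain n :: int where "circle_rep (circle_of s) = s + of_int n * (2 * pi)"
    unfolding circle_of_eq_iff by blast
  then have "circle_rep (circle_of s) / (2 * pi) = s / (2 * pi) + of_int n"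
    by (simp add: add_divide_distrib)
  then have "2 * pi * degree_one_lift \<phi> (circle_rep (circle_of s) / (2 * pi)) =
      2 * pi * degree_one_lift \<phi> (s / (2 * pi)) + of_int n * (2 * pi)"
    by (simp add: degree_one_lift_add_int distrib_left)
  then show ?thesis
    unfolding circle_map_def by (metis circle_of_eq_iff)
qed

text \<open>
  By the definition of the quotient topology, continuity can be tested on the line.
\<close>

lemma continuous_circle_map:
  assumes "end_fixing \<phi>"
  shows "continuous_on UNIV (circle_map \<phi>)"
proof -
  have "continuous_on UNIV (\<lambda>s. circle_of (2 * pi * degree_one_lift \<phi> (s / (2 * pi))))"
    by (intro continuous_on_compose2[OF continuous_circle_of] continuous_intros
        continuous_on_compose2[OF continuous_degree_one_lift[OF assms]]) auto
  then show ?thesis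
    unfolding continuous_on_open_vimage[OF open_UNIV]
    by (simp add: open_circle_def vimage_def circle_map_circle_of)
qed

lemma circle_map_inverse:
  assumes "end_fixing \<phi>" "end_fixing \<psi>" "\<And>t. 0 \<le> t \<Longrightarrow> t \<le> 1 \<Longrightarrow> \<psi> (\<phi> t) = t"
  shows "circle_map \<psi> (circle_map \<phi> c) = c"
  unfolding circle_map_def[of \<phi>] circle_map_circle_of
  by (simp add: degree_one_lift_inverse[OF assms] circle_of_circle_rep)

section \<open>Fourier coefficients of functions with a prescribed modulus of continuity\<close>

lemma H_class_bound:
  assumes "f \<in> H_class \<omega>"
  obtains C d where "0 \<le> C" "0 < d"
    "\<And>\<delta> s t. 0 < \<delta> \<Longrightarrow> \<delta> < d \<Longrightarrow> \<bar>s - t\<bar> < \<delta> \<Longrightarrow> \<bar>f (circle_of s) - f (circle_of t)\<bar> \<le> C * \<bar>\<omega> \<delta>\<bar>"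
proof -
  obtain C where "\<forall>\<^sub>F \<delta> in at_right 0. modulus_of_continuity \<delta> f \<le> ereal (C * \<omega> \<delta>)"
    using assms by (auto simp: H_class_def)
  then obtain d where d: "0 < d" "\<And>\<delta>. 0 < \<delta> \<Longrightarrow> \<delta> < d \<Longrightarrow> modulus_of_continuity \<delta> f \<le> ereal (C * \<omega> \<delta>)"
    unfolding eventually_at_right_field by blast
  have "\<bar>f (circle_of s) - f (circle_of t)\<bar> \<le> \<bar>C\<bar> * \<bar>\<omega> \<delta>\<bar>"
    if "0 < \<delta>" "\<delta> < d" "\<bar>s - t\<bar> < \<delta>" for \<delta> s t
  proof -
    have "ereal \<bar>f (circle_of s) - f (circle_of t)\<bar> \<le> modulus_of_continuity \<delta> f"
      unfolding modulus_of_continuity_def using that by (intro SUP_upper2[of "(s, t)"]) auto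
    also have "\<dots> \<le> ereal (C * \<omega> \<delta>)"
      using that d by blast
    finally show ?thesis
      by (simp flip: abs_mult)
  qed
  with d(1) show thesis
    by (intro that[of "\<bar>C\<bar>" d]) auto
qed

lemma small_modulus:
  fixes \<omega> :: "real \<Rightarrow> real"
  assumes "continuous_on {0..} \<omega>" "\<omega> 0 = 0" "0 < e"
  obtains d where "0 < d" "\<And>\<delta>. 0 \<le> \<delta> \<Longrightarrow> \<delta> < d \<Longrightarrow> \<bar>\<omega> \<delta>\<bar> < e"
proof -
  obtain d where "0 < d" "\<And>x. x \<in> {0..} \<Longrightarrow> dist x 0 < d \<Longrightarrow> dist (\<omega> x) (\<omega> 0) < e"
    using assms unfolding continuous_on_iff by (metis atLeast_iff order_refl)
  then show thesis
    using assms by (intro that[of d]) auto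
qed

lemma H_class_continuous:
  assumes f: "f \<in> H_class \<omega>" and \<omega>: "continuous_on {0..} \<omega>" "\<omega> 0 = 0"
  shows "continuous_on UNIV (\<lambda>s. f (circle_of s))"
  unfolding continuous_on_iff
proof (intro ballI allI impI)
  fix s e :: real assume "0 < e"
  obtain C d where C: "0 \<le> C" "0 < d" and bd: "\<And>\<delta> s t. 0 < \<delta> \<Longrightarrow> \<delta> < d \<Longrightarrow> \<bar>s - t\<bar> < \<delta> \<Longrightarrow>
      \<bar>f (circle_of s) - f (circle_of t)\<bar> \<le> C * \<bar>\<omega> \<delta>\<bar>"
    using H_class_bound[OF f] by metis
  have "0 < e / (C + 1)"
    using \<open>0 < e\<close> C by simp
  from small_modulus[OF \<omega> this] obtain d' where
    d': "0 < d'" "\<And>\<delta>. 0 \<le> \<delta> \<Longrightarrow> \<delta> < d' \<Longrightarrow> \<bar>\<omega> \<delta>\<bar> < e / (C + 1)" by metis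
  define \<delta> where "\<delta> = min d d' / 2"
  have \<delta>: "0 < \<delta>" "\<delta> < d" "\<delta> < d'"
    using C d'(1) by (auto simp: \<delta>_def min_def)
  have "C * \<bar>\<omega> \<delta>\<bar> \<le> C * (e / (C + 1))"
    using C d'(2)[of \<delta>] \<delta> by (intro mult_left_mono) auto
  also have "\<dots> < e"
    using C \<open>0 < e\<close> by (simp add: field_simps)
  finally have "C * \<bar>\<omega> \<delta>\<bar> < e" .
  then show "\<exists>\<delta>>0. \<forall>t\<in>UNIV. dist t s < \<delta> \<longrightarrow> dist (f (circle_of t)) (f (circle_of s)) < e"
    using bd[OF \<delta>(1,2)] \<delta>(1) unfolding dist_real_def by (meson le_less_trans)
qed

text \<open>
  The substitution \<open>t = 2 \<pi> s\<close> transforms one period into the unit interval; the factor \<open>2 \<pi>\<close> cancels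
  the normalisation of the coefficients.
\<close>

lemma fourier_coeff_circle_map:
  assumes f: "continuous_on UNIV (\<lambda>s. f (circle_of s))" and \<phi>: "end_fixing \<phi>"
  shows "fourier_coeff (\<lambda>x. complex_of_real ((f \<circ> circle_map \<phi>) x)) k =
    osc_integral (\<lambda>t. f (circle_of (2 * pi * \<phi> t))) (- 2 * pi * of_int k)"
proof -
  let ?G = "\<lambda>t. complex_of_real (f (circle_of (2 * pi * \<phi> t))) * cis (- 2 * pi * of_int k * t)"
  let ?F = "\<lambda>t. complex_of_real ((f \<circ> circle_map \<phi>) (circle_of t)) * exp (- (\<i> * of_int k * of_real t))"
  have cont: "continuous_on {0..1} ?G"
    by (intro continuous_intros continuous_on_compose2[OF f] end_fixingD(1)[OF \<phi>]) auto
  have FG: "?G ((t - 0) / (2 * pi)) = ?F t" if "t \<in> {0..0 + 2 * pi}" for t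
  proof -
    have "0 \<le> t / (2 * pi)" "t / (2 * pi) \<le> 1"
      using that by auto
    then show ?thesis
      by (simp add: circle_map_circle_of degree_one_lift_unit_interval[OF \<phi>] cis_conv_exp mult_ac)
  qed
  have "continuous_on {0..2 * pi} (\<lambda>t. ?G (t / (2 * pi)))"
    by (rule continuous_on_compose2[OF cont]) (auto intro!: continuous_intros)
  then have "continuous_on {0..2 * pi} ?F"
    by (rule continuous_on_eq) (use FG in auto)
  then have "set_integrable lebesgue {0..2 * pi} ?F"
    by (rule absolutely_integrable_continuous_real)
  then have "(LINT t:{0..2 * pi}|lebesgue. ?F t) = integral {0..2 * pi} ?F"
    by (rule set_lebesgue_integral_eq_integral)
  also have "(?F has_integral of_real (2 * pi) * integral {0..1} ?G) {0..0 + 2 * pi}"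
    by (rule has_integral_eq[OF FG integral_rescale[OF _ cont]]) auto
  then have "integral {0..2 * pi} ?F = of_real (2 * pi) * integral {0..1} ?G"
    by (simp add: integral_unique)
  finally show ?thesis
    by (simp add: fourier_coeff_def osc_integral_def)
qed

text \<open>
  The factor \<open>8\<close> is any number above \<open>2 \<pi>\<close>: the modulus of continuity is stated with a strict
  inequality between the points.
\<close>

lemma rescaled_test_function:
  assumes bd: "\<And>s t. \<bar>s - t\<bar> < 8 * \<epsilon> \<Longrightarrow> \<bar>f (circle_of s) - f (circle_of t)\<bar> \<le> \<eta>"
    and f: "continuous_on UNIV (\<lambda>s. f (circle_of s))"
    and M: "\<And>c. \<bar>f c\<bar> \<le> M" and "0 < \<epsilon>"
  shows "(\<lambda>x. f (circle_of (2 * pi * x))) \<in> test_functions M \<epsilon> \<eta>"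
proof -
  have "\<bar>2 * pi * x - 2 * pi * y\<bar> < 8 * \<epsilon>" if "\<bar>x - y\<bar> \<le> \<epsilon>" for x y
  proof -
    have "\<bar>2 * pi * x - 2 * pi * y\<bar> = 2 * pi * \<bar>x - y\<bar>"
      by (simp add: abs_mult flip: right_diff_distrib)
    also have "\<dots> \<le> 2 * pi * \<epsilon>"
      using that by simp
    also have "\<dots> < 8 * \<epsilon>"
      using pi_less_4 \<open>0 < \<epsilon>\<close> by simp
    finally show ?thesis .
  qed
  moreover have "continuous_on {0..1} (\<lambda>x. f (circle_of (2 * pi * x)))"
    by (intro continuous_on_compose2[OF f] continuous_intros) auto
  ultimately show ?thesis
    using M bd by (auto simp: test_functions_def)
qed

lemma continuous_on_circle_bounded:
  assumes f: "continuous_on UNIV (\<lambda>s. f (circle_of s))"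
  obtains M :: real where "0 \<le> M" "\<And>c. \<bar>f c\<bar> \<le> M"
proof -
  have "compact ((\<lambda>s. f (circle_of s)) ` {0..2 * pi})"
    by (intro compact_continuous_image continuous_on_subset[OF f]) auto
  then obtain M where M: "\<And>s. s \<in> {0..2 * pi} \<Longrightarrow> \<bar>f (circle_of s)\<bar> \<le> M"
    by (meson compact_imp_bounded bounded_real imageI)
  have "\<bar>f c\<bar> \<le> M" for c
  proof -
    define x where "x = circle_rep c / (2 * pi)"
    have "2 * pi * frac x = circle_rep c + of_int (- \<lfloor>x\<rfloor>) * (2 * pi)"
      by (simp add: x_def frac_def algebra_simps)
    then have "circle_of (2 * pi * frac x) = c"
      by (metis circle_of_eq_iff circle_of_circle_rep)
    moreover have "2 * pi * frac x \<in> {0..2 * pi}"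
      using frac_lt_1[of x] frac_ge_0[of x] by (auto intro: mult_left_le less_imp_le)
    ultimately show ?thesis
      using M by metis
  qed
  then show thesis
    using that[of M] by (meson abs_ge_zero order_trans)
qed

theorem theorem1:
  fixes lam :: "nat \<Rightarrow> real" and \<omega> :: "real \<Rightarrow> real"
  assumes "filterlim lam at_top sequentially"
    and "mono_on {0..} \<omega>" and "continuous_on {0..} \<omega>" and "\<omega> 0 = 0"
  shows "\<exists>h h' :: circle \<Rightarrow> circle. homeomorphism UNIV UNIV h h' \<and>
    (\<forall>f \<in> H_class \<omega>.
       (\<lambda>k::int. cmod (fourier_coeff (\<lambda>x. complex_of_real ((f \<circ> h) x)) k))
         \<in> O[filtercomap abs at_top](\<lambda>k. lam (nat \<bar>k\<bar>) / real_of_int \<bar>k\<bar>))"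
proof -
  \<comment> \<open>The condition \<open>r \<le> K r\<close> makes the set of indices \<open>r\<close> with \<open>K r \<le> n\<close> finite.\<close>
  have "\<exists>N. r \<le> N \<and> (\<forall>k\<ge>N. 4 ^ r \<le> lam k)" for r :: nat
  proof -
    obtain N where "\<forall>k\<ge>N. 4 ^ r \<le> lam k"
      using assms(1) unfolding filterlim_at_top eventually_sequentially by blast
    then show ?thesis
      by (intro exI[of _ "max r N"]) auto
  qed
  then obtain K :: "nat \<Rightarrow> nat" where K: "\<And>r. r \<le> K r" "\<And>r k. K r \<le> k \<Longrightarrow> 4 ^ r \<le> lam k"
    by metis
  \<comment> \<open>The bound \<open>1 / (r + 1)\<close> forces the scales to \<open>0\<close> even if \<open>\<omega>\<close> vanishes near \<open>0\<close>: the
      modulus of continuity of \<open>f\<close> is controlled below some scale only, which depends on \<open>f\<close>.\<close>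
  have "\<exists>x. 0 < x \<and> x < 1 \<and> x \<le> 1 / (real r + 1) \<and> \<bar>\<omega> (8 * x)\<bar> \<le> 1 / (real (K (Suc r)) + 1)" for r
  proof -
    obtain d where d: "0 < d" "\<And>\<delta>. 0 \<le> \<delta> \<Longrightarrow> \<delta> < d \<Longrightarrow> \<bar>\<omega> \<delta>\<bar> < 1 / (real (K (Suc r)) + 1)"
      using small_modulus[OF assms(3,4), of "1 / (real (K (Suc r)) + 1)"] by auto
    define x where "x = min (d / 16) (1 / (real r + 2))"
    have x: "0 < x" "x \<le> d / 16" "x \<le> 1 / (real r + 2)"
      using d(1) by (auto simp: x_def)
    moreover have "1 / (real r + 2) < 1" "1 / (real r + 2) \<le> 1 / (real r + 1)"
      by (auto simp: field_simps)
    ultimately have "0 < x" "x < 1" "x \<le> 1 / (real r + 1)" "8 * x < d"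
      using d(1) by linarith+
    then show ?thesis
      using d(2)[of "8 * x"] by (intro exI[of _ x]) auto
  qed
  then obtain a :: "nat \<Rightarrow> real" where scale: "\<And>r. 0 < a r" "\<And>r. a r < 1"
    "\<And>r. a r \<le> 1 / (real r + 1)" "\<And>r. \<bar>\<omega> (8 * a r)\<bar> \<le> 1 / (real (K (Suc r)) + 1)"
    by metis
  define b where "b r = 1 - 1 / (real (K (Suc r)) + 2)" for r
  interpret ratios a b
    by unfold_locales (auto simp: scale b_def field_simps)
  have ba: "ratios b a"
    using ratios.a ratios.b by unfold_locales (auto simp: a b)
  let ?H = "limit_map a b 0" and ?H' = "limit_map b a 0"
  have H: "end_fixing ?H" "end_fixing ?H'"
    using end_fixing_limit_map ratios.end_fixing_limit_map[OF ba] by auto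
  have "homeomorphism UNIV UNIV (circle_map ?H) (circle_map ?H')"
    using circle_map_inverse[OF H] circle_map_inverse[OF H(2,1)] continuous_circle_map H
      limit_map_inverse[OF ratios_axioms] limit_map_inverse[OF ba]
    by (intro homeomorphismI) auto
  moreover have "(\<lambda>k::int. cmod (fourier_coeff (\<lambda>x. complex_of_real ((f \<circ> circle_map ?H) x)) k))
         \<in> O[filtercomap abs at_top](\<lambda>k. lam (nat \<bar>k\<bar>) / real_of_int \<bar>k\<bar>)"
    if f: "f \<in> H_class \<omega>" for f
  proof -
    have cont: "continuous_on UNIV (\<lambda>s. f (circle_of s))"
      using H_class_continuous[OF f assms(3,4)] .
    obtain M where M: "0 \<le> M" "\<And>c. \<bar>f c\<bar> \<le> M"
      using continuous_on_circle_bounded[OF cont] by metis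
    obtain C d where C: "0 \<le> C" "0 < d" and bd: "\<And>\<delta> s t. 0 < \<delta> \<Longrightarrow> \<delta> < d \<Longrightarrow> \<bar>s - t\<bar> < \<delta> \<Longrightarrow>
        \<bar>f (circle_of s) - f (circle_of t)\<bar> \<le> C * \<bar>\<omega> \<delta>\<bar>"
      using H_class_bound[OF f] by metis
    obtain r0 :: nat where r0: "8 / d < real r0"
      using reals_Archimedean2 by blast
    have bound: "cmod (fourier_coeff (\<lambda>x. complex_of_real ((f \<circ> circle_map ?H) x)) k)
        \<le> (2 * M + C) * (lam (nat \<bar>k\<bar>) / \<bar>of_int k\<bar>)"
      and nonneg: "0 \<le> lam (nat \<bar>k\<bar>)"
      if k: "int (K r0) + 1 \<le> \<bar>k\<bar>" for k
    proof -
      define n where "n = nat \<bar>k\<bar>"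
      have n: "K r0 \<le> n" "0 < n" "\<bar>real_of_int k\<bar> = real n"
        using k by (auto simp: n_def)
      \<comment> \<open>The largest index with \<open>K r \<le> n\<close>, which gives \<open>n < K (Suc r)\<close>.\<close>
      define r where "r = Max {r. K r \<le> n}"
      have "{r. K r \<le> n} \<subseteq> {..n}"
        using K(1) order_trans by blast
      then have fin: "finite {r. K r \<le> n}"
        using finite_subset by blast
      have "r \<in> {r. K r \<le> n}"
        unfolding r_def using fin n(1) by (intro Max_in) auto
      moreover have "r0 \<le> r"
        unfolding r_def using fin n(1) by (intro Max_ge) auto
      moreover have "\<not> K (Suc r) \<le> n"
        using Max_ge[OF fin, of "Suc r"] unfolding r_def by auto
      ultimately have r: "K r \<le> n" "r0 \<le> r" "n < K (Suc r)"
        by auto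
      have lam: "4 ^ r \<le> lam n" "1 \<le> lam n"
        using K(2)[OF r(1)] order_trans[OF one_le_power[of "4::real" r] K(2)[OF r(1)]] by auto
      then show "0 \<le> lam (nat \<bar>k\<bar>)"
        by (simp add: n_def)
      let ?\<eta> = "C * \<bar>\<omega> (8 * a r)\<bar>"
      have "8 * a r \<le> 8 / (real r + 1)"
        using scale(3)[of r] by simp
      also have "\<dots> < d"
      proof -
        have "8 / d < real r + 1"
          using r0 r(2) by linarith
        then show ?thesis
          using C(2) by (simp add: field_simps)
      qed
      finally have small: "8 * a r < d" .
      have test: "(\<lambda>x. f (circle_of (2 * pi * x))) \<in> test_functions M (a r) ?\<eta>"
        using small scale(1)[of r] by (intro rescaled_test_function bd cont M) auto
      have "osc_bounded ?H (test_functions M (a r) ?\<eta>) (4 ^ r * (2 * M)) (?\<eta> + M * (1 - b r))"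
        using osc_bounded_limit_map[of 0 r "a r" ?\<eta> M] C by simp
      then have "norm (osc_integral (\<lambda>t. f (circle_of (2 * pi * ?H t))) (- 2 * pi * of_int k))
          \<le> 4 ^ r * (2 * M) / \<bar>- 2 * pi * of_int k\<bar> + (?\<eta> + M * (1 - b r))"
        by (rule osc_boundedD[OF _ test]) (use n in auto)
      also have "\<dots> \<le> M * (lam n / real n) + (C * (lam n / real n) + M * (lam n / real n))"
      proof (intro add_mono)
        have inv: "1 / (real (K (Suc r)) + 1) \<le> lam n / real n" "1 / (real (K (Suc r)) + 2) \<le> lam n / real n"
          using r(3) n(2) lam(2) by (auto intro!: frac_le)
        show "?\<eta> \<le> C * (lam n / real n)"
          using C scale(4)[of r] inv by (intro mult_left_mono) auto
        show "M * (1 - b r) \<le> M * (lam n / real n)"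
          using M inv by (intro mult_left_mono) (auto simp: b_def)
        have "\<bar>- 2 * pi * of_int k\<bar> = 2 * pi * real n"
          using n(3) by (simp add: abs_mult)
        then have "4 ^ r * (2 * M) / \<bar>- 2 * pi * of_int k\<bar> = (M * (4 ^ r / real n)) / pi"
          using n(2) by (simp add: field_simps)
        also have "\<dots> \<le> (M * (4 ^ r / real n)) / 1"
          using M pi_gt3 by (intro divide_left_mono) auto
        also have "\<dots> \<le> M * (lam n / real n)"
          using M lam by (auto intro!: mult_left_mono divide_right_mono)
        finally show "4 ^ r * (2 * M) / \<bar>- 2 * pi * of_int k\<bar> \<le> M * (lam n / real n)" .
      qed
      also have "\<dots> = (2 * M + C) * (lam n / real n)"
        by (simp only: distrib_right mult_2 add_ac)
      also have "\<dots> = (2 * M + C) * (lam (nat \<bar>k\<bar>) / \<bar>of_int k\<bar>)"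
        unfolding n(3) n_def ..
      finally show "cmod (fourier_coeff (\<lambda>x. complex_of_real ((f \<circ> circle_map ?H) x)) k)
          \<le> (2 * M + C) * (lam (nat \<bar>k\<bar>) / \<bar>of_int k\<bar>)"
        by (simp only: fourier_coeff_circle_map[OF cont H(1)])
    qed
    have "\<forall>\<^sub>F k in filtercomap abs at_top. int (K r0) + 1 \<le> \<bar>k\<bar>"
      by (intro eventually_filtercomapI eventually_ge_at_top)
    then show ?thesis
      by (intro bigoI[of _ "2 * M + C"], eventually_elim) (use bound nonneg in simp)
  qed
  ultimately show ?thesis
    by blast
qed

end
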